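(* Let $A\in\mathbb{R}^{n\times m}$, $b\in\mathbb{R}^n$, $\alpha>0$ and $L\in\mathbb{R}^{\ell\times m}$. Put $\Gamma=L^\dag L^{\dag*}$, $B=AL^\dag$, and let $\tilde B_k$ be a rank-$k$ randomized SVD (RSVD) approximation of $B$. If $\mathcal{N}(L)=\{0\}$, then the approximation $\tilde x_\alpha=\Gamma A^*(\tilde B_k\tilde B_k^*+\alpha I)^{-1}b$ is equivalent to RSVD for the dual problem of the general Tikhonov problem of minimizing $\frac12\|Ax-b\|^2+\frac\alpha2\|Lx\|^2$ over $x\in\mathbb{R}^m$ (in the sense explained in the context).
   Context: $\|\cdot\|$ is the Euclidean norm for vectors; $M^*$ is the transpose, $M^\dag$ the Moore–Penrose pseudoinverse, $M^{\dag*}=(M^\dag)^*$, and $\mathcal{N}(M)$ the kernel of a matrix $M$; $I$ is the identity matrix. Dual problem: by Fenchel duality, the dual of minimizing $\frac12\|Ax-b\|^2+\frac\alpha2\|Lx\|^2$ is (up to an additive constant) to maximize $-\frac1{2\alpha}\|L^{\dag*}A^*\xi\|^2-\frac12\|\xi-b\|^2=-\frac1{2\alpha}\|B^*\xi\|^2-\frac12\|\xi-b\|^2$ over $\xi\in\mathbb{R}^n$. The optimal primal–dual pair $(x_\alpha,\xi_\alpha)$ satisfies $\alpha L^*Lx_\alpha=A^*\xi_\alpha$ and $\xi_\alpha=b-Ax_\alpha$, so that $x_\alpha=\alpha^{-1}\Gamma A^*\xi_\alpha$ when $\mathcal{N}(L)=\{0\}$. Meaning of "RSVD for the dual problem": replace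 $B$ by its RSVD approximation $\tilde B_k$ in the dual problem, solve for $\tilde\xi_\alpha=\arg\max_{\xi\in\mathbb{R}^n}\{-\frac1{2\alpha}\|\tilde B_k^*\xi\|^2-\frac12\|\xi-b\|^2\}$, and recover a primal approximation through the duality relation as $\alpha^{-1}\Gamma A^*\tilde\xi_\alpha$. Equivalence means that this primal approximation is $\tilde x_\alpha$. RSVD approximation of rank $k\ge1$ of $B\in\mathbb{R}^{n\times\ell}$, with integer parameters $p\ge0$, $q\ge0$ and $k+p\le\min(n,\ell)$. Case $n\ge\ell$: sample a standard Gaussian matrix $\Omega\in\mathbb{R}^{\ell\times(k+p)}$, form $Y=(BB^* )^qB\Omega$, let $Q\in\mathbb{R}^{n\times(k+p)}$ be an orthonormal basis of the range of $Y$, and compute an SVD $Q^*B=WSV^*$ with singular values in nonincreasing order. With $\tilde U_k$ the first $k$ columns of $QW$, $\tilde\Sigma_k$ the leading $k\times k$ block of $S$ and $\tilde V_k$ the first $k$ columns of $V$, set $\tilde B_k=\tilde U_k\tilde\Sigma_k\tilde V_k^*$. Case $n<\ell$: the same procedure is applied to $B^*$ and the result is transposed. *)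

theory Defs
  imports
    "HOL-Probability.Probability"
    "Jordan_Normal_Form.Gauss_Jordan_Elimination"
    "Jordan_Normal_Form.Matrix_Kernel"
begin

unbundle no inner_syntax
unbundle no vec_syntax

definition vec_norm :: "real vec \<Rightarrow> real" where
  "vec_norm v = sqrt (scalar_prod v v)"

text \<open>The Moore--Penrose pseudoinverse, as the unique solution of the four Penrose equations.\<close>

definition is_pinv :: "real mat \<Rightarrow> real mat \<Rightarrow> bool" where
  "is_pinv M X \<longleftrightarrow>
     X \<in> carrier_mat (dim_col M) (dim_row M) \<and>
     M * X * M = M \<and> X * M * X = X \<and>
     transpose_mat (M * X) = M * X \<and> transpose_mat (X * M) = X * M"

definition pinv :: "real mat \<Rightarrow> real mat" where
  "pinv M = (THE X. is_pinv M X)"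

text \<open>Only meaningful for invertible matrices.\<close>

definition inv_mat :: "real mat \<Rightarrow> real mat" where
  "inv_mat M = the (mat_inverse M)"

definition mat_range :: "real mat \<Rightarrow> real vec set" where
  "mat_range M = (\<lambda>v. M *\<^sub>v v) ` carrier_vec (dim_col M)"

text \<open>Top-left \<open>r\<close> by \<open>c\<close> block.\<close>

definition leading_block :: "nat \<Rightarrow> nat \<Rightarrow> real mat \<Rightarrow> real mat" where
  "leading_block r c M = Matrix.mat r c (\<lambda>(i, j). M $$ (i, j))"

text \<open>Full singular value decomposition \<open>M = W S V\<^sup>T\<close>: \<open>W\<close> and \<open>V\<close> are square orthogonal
  matrices, \<open>S\<close> is rectangular of the same shape as \<open>M\<close>. Note that \<^const>\<open>diagonal_mat\<close>
  does not require a square matrix.\<close>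

definition is_svd :: "real mat \<Rightarrow> real mat \<Rightarrow> real mat \<Rightarrow> real mat \<Rightarrow> bool" where
  "is_svd M W S V \<longleftrightarrow>
     W \<in> carrier_mat (dim_row M) (dim_row M) \<and> transpose_mat W * W = 1\<^sub>m (dim_row M) \<and>
     V \<in> carrier_mat (dim_col M) (dim_col M) \<and> transpose_mat V * V = 1\<^sub>m (dim_col M) \<and>
     S \<in> carrier_mat (dim_row M) (dim_col M) \<and> diagonal_mat S \<and>
     (\<forall>i < min (dim_row M) (dim_col M). 0 \<le> S $$ (i, i)) \<and>
     (\<forall>i j. i \<le> j \<longrightarrow> j < min (dim_row M) (dim_col M) \<longrightarrow> S $$ (j, j) \<le> S $$ (i, i)) \<and>
     M = W * S * transpose_mat V"

text \<open>The matrix \<open>Q\<close> has exactly \<open>k + p\<close> orthonormal columns. If \<open>Y\<close> has full column rank,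
  the inclusion of ranges is an equality for dimension reasons, so the columns of \<open>Q\<close> are an
  orthonormal basis of the range of \<open>Y\<close>. If \<open>Y\<close> is rank deficient (e.g. when \<open>B\<close> has rank less
  than \<open>k + p\<close>), such a basis has fewer than \<open>k + p\<close> vectors and is completed to an orthonormal
  system of size \<open>k + p\<close>, as in a QR factorization of \<open>Y\<close>.\<close>

definition rsvd_tall ::
    "real mat \<Rightarrow> nat \<Rightarrow> nat \<Rightarrow> nat \<Rightarrow> real mat \<Rightarrow> real mat \<Rightarrow> bool" where
  "rsvd_tall B k p q \<Omega> Bk \<longleftrightarrow>
     (\<exists>Q W S V.
        Q \<in> carrier_mat (dim_row B) (k + p) \<and>
        transpose_mat Q * Q = 1\<^sub>m (k + p) \<and>
        mat_range (((B * transpose_mat B) ^\<^sub>m q) * B * \<Omega>) \<subseteq> mat_range Q \<and>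
        is_svd (transpose_mat Q * B) W S V \<and>
        Bk = leading_block (dim_row B) k (Q * W) * leading_block k k S *
             transpose_mat (leading_block (dim_col B) k V))"

text \<open>\<open>is_rsvd B k p q \<Omega> Bk\<close>: the matrix \<open>Bk\<close> is an output of the randomized SVD of \<open>B\<close> with
  target rank \<open>k\<close>, oversampling \<open>p\<close> and \<open>q\<close> power iterations, run on the sample \<open>\<Omega>\<close>. It is a
  relation because \<open>Q\<close> and the SVD are not unique.\<close>

definition is_rsvd ::
    "real mat \<Rightarrow> nat \<Rightarrow> nat \<Rightarrow> nat \<Rightarrow> real mat \<Rightarrow> real mat \<Rightarrow> bool" where
  "is_rsvd B k p q \<Omega> Bk \<longleftrightarrow>
     (if dim_col B \<le> dim_row B then rsvd_tall B k p q \<Omega> Bk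
      else (\<exists>C. rsvd_tall (transpose_mat B) k p q \<Omega> C \<and> Bk = transpose_mat C))"

definition std_gaussian_matrix ::
    "'w measure \<Rightarrow> nat \<Rightarrow> nat \<Rightarrow> ('w \<Rightarrow> real mat) \<Rightarrow> bool" where
  "std_gaussian_matrix M r c \<Omega> \<longleftrightarrow>
     prob_space M \<and>
     (\<forall>\<omega> \<in> space M. \<Omega> \<omega> \<in> carrier_mat r c) \<and>
     prob_space.indep_vars M (\<lambda>_. borel) (\<lambda>ij \<omega>. \<Omega> \<omega> $$ ij) ({..<r} \<times> {..<c}) \<and>
     (\<forall>ij \<in> {..<r} \<times> {..<c}.
        distributed M lborel (\<lambda>\<omega>. \<Omega> \<omega> $$ ij) (\<lambda>x. ennreal (std_normal_density x)))"

text \<open>For \<open>B = A L\<^sup>\<dagger>\<close>, so that \<open>B\<^sup>T = L\<^sup>\<dagger>\<^sup>T A\<^sup>T\<close>, maximizing this function of \<open>\<xi>\<close> is, up to an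
  additive constant, the Fenchel dual of minimizing
  \<open>1/2 |A x - b|\<^sup>2 + \<alpha>/2 |L x|\<^sup>2\<close> over \<open>x\<close>.\<close>

definition tikhonov_dual :: "real \<Rightarrow> real mat \<Rightarrow> real vec \<Rightarrow> real vec \<Rightarrow> real" where
  "tikhonov_dual \<alpha> B b \<xi> =
     - (1 / (2 * \<alpha>)) * (vec_norm (transpose_mat B *\<^sub>v \<xi>))\<^sup>2 - (1 / 2) * (vec_norm (\<xi> - b))\<^sup>2"

end

theory Submission
  imports Defs "Jordan_Normal_Form.Determinant"
begin

text \<open>The matrix \<open>G = C C\<^sup>T + \<alpha> I\<close> is positive definite, hence invertible, and the dual objective
  is a strictly concave quadratic whose stationarity condition is \<open>G \<xi> = \<alpha> b\<close>. Completing the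
  square at \<open>\<xi>\<^sub>0 = \<alpha> G\<^sup>-\<^sup>1 b\<close> shows that \<open>\<xi>\<^sub>0\<close> is the only maximizer; the factor \<open>\<alpha>\<close> cancels in
  \<open>\<alpha>\<^sup>-\<^sup>1 \<Gamma> A\<^sup>T \<xi>\<^sub>0\<close>.\<close>

lemma vec_norm_sq: "(vec_norm v)\<^sup>2 = v \<bullet> v"
  unfolding vec_norm_def by (simp add: scalar_prod_def sum_nonneg)

lemma vec_norm_sq_eq_0_iff:
  assumes "v \<in> carrier_vec n"
  shows "(vec_norm v)\<^sup>2 = 0 \<longleftrightarrow> v = 0\<^sub>v n"
  using assms unfolding vec_norm_sq
  by (auto simp: scalar_prod_def sum_nonneg_eq_0_iff)

lemma vec_norm_sq_add:
  assumes "u \<in> carrier_vec n" "v \<in> carrier_vec n"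
  shows "(vec_norm (u + v))\<^sup>2 = (vec_norm u)\<^sup>2 + 2 * (u \<bullet> v) + (vec_norm v)\<^sup>2"
  using assms comm_scalar_prod[OF assms]
  by (simp add: vec_norm_sq add_scalar_prod_distrib[of _ n] scalar_prod_add_distrib[of _ n])

text \<open>Adjointness of \<open>C\<close> and its transpose. It turns quadratic forms of
  \<open>C * transpose_mat C\<close> into squared norms, and mixed terms of the dual objective into
  terms of the stationarity equation.\<close>

lemma scalar_prod_gram:
  fixes C :: "real mat"
  assumes C: "C \<in> carrier_mat n r" and u: "u \<in> carrier_vec n" and v: "v \<in> carrier_vec n"
  shows "(transpose_mat C *\<^sub>v u) \<bullet> (transpose_mat C *\<^sub>v v) = ((C * transpose_mat C) *\<^sub>v u) \<bullet> v"
proof -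
  have "(transpose_mat C *\<^sub>v u) \<bullet> (transpose_mat C *\<^sub>v v)
      = (transpose_mat C *\<^sub>v v) \<bullet> (transpose_mat C *\<^sub>v u)"
    using assms by (intro comm_scalar_prod[of _ r]) auto
  also have "\<dots> = v \<bullet> (C *\<^sub>v (transpose_mat C *\<^sub>v u))"
    using assms by (intro transpose_vec_mult_scalar[of _ n r]) auto
  also have "\<dots> = (C *\<^sub>v (transpose_mat C *\<^sub>v u)) \<bullet> v"
    using assms by (intro comm_scalar_prod[of _ n]) auto
  finally show ?thesis using assms by simp
qed

text \<open>Free of carrier conditions because \<open>scalar_prod\<close> sums over the indices of
  its second argument, here \<open>v\<close>. It therefore applies to \<Gamma> without computing the
  dimensions of \<open>pinv L\<close>.\<close>

lemma mult_mat_vec_smult: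
  fixes M :: "'a :: comm_semiring_1 mat"
  shows "M *\<^sub>v (c \<cdot>\<^sub>v v) = c \<cdot>\<^sub>v (M *\<^sub>v v)"
  by (intro eq_vecI) (auto simp: scalar_prod_def sum_distrib_left ac_simps)

lemma regularized_gram_mult_vec:
  fixes C :: "real mat"
  assumes "C \<in> carrier_mat n r" and "v \<in> carrier_vec n"
  shows "(C * transpose_mat C + \<alpha> \<cdot>\<^sub>m 1\<^sub>m n) *\<^sub>v v = (C * transpose_mat C) *\<^sub>v v + \<alpha> \<cdot>\<^sub>v v"
proof -
  have "(\<alpha> \<cdot>\<^sub>m 1\<^sub>m n) *\<^sub>v v = \<alpha> \<cdot>\<^sub>v v"
    using assms by (intro eq_vecI) auto
  then show ?thesis
    using assms by (simp add: add_mult_distrib_mat_vec[of _ n n] del: assoc_mult_mat_vec)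
qed

text \<open>Pairing a kernel vector v with its zero image gives |C^T v|^2 + \<alpha> |v|^2 = 0,
  which forces v = 0 as \<alpha> > 0.\<close>

lemma det_regularized_gram_nonzero:
  fixes C :: "real mat"
  assumes C: "C \<in> carrier_mat n r" and \<alpha>: "\<alpha> > 0"
  shows "det (C * transpose_mat C + \<alpha> \<cdot>\<^sub>m 1\<^sub>m n) \<noteq> 0"
proof
  let ?K = "C * transpose_mat C"
  let ?G = "?K + \<alpha> \<cdot>\<^sub>m 1\<^sub>m n"
  have K: "?K \<in> carrier_mat n n" and G: "?G \<in> carrier_mat n n" using C by auto
  assume "det ?G = 0"
  then obtain v where v: "v \<in> carrier_vec n" "v \<noteq> 0\<^sub>v n" "?G *\<^sub>v v = 0\<^sub>v n"
    using det_0_iff_vec_prod_zero[OF G] by blast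
  have "0 = (?G *\<^sub>v v) \<bullet> v"
    using v by simp
  also have "\<dots> = (?K *\<^sub>v v) \<bullet> v + \<alpha> * (v \<bullet> v)"
    unfolding regularized_gram_mult_vec[OF C v(1)]
    using v mult_mat_vec_carrier[OF K v(1)]
    by (subst add_scalar_prod_distrib[of _ n]) (auto simp del: assoc_mult_mat_vec)
  also have "\<dots> = (vec_norm (transpose_mat C *\<^sub>v v))\<^sup>2 + \<alpha> * (vec_norm v)\<^sup>2"
    unfolding scalar_prod_gram[OF C v(1) v(1), symmetric] vec_norm_sq ..
  finally have "(vec_norm (transpose_mat C *\<^sub>v v))\<^sup>2 + \<alpha> * (vec_norm v)\<^sup>2 = 0" ..
  moreover have "(vec_norm v)\<^sup>2 > 0"
    using vec_norm_sq_eq_0_iff[OF v(1)] v(2) by (simp add: less_le)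
  ultimately show False
    using \<alpha> by (smt (verit) mult_pos_pos zero_le_power2)
qed

lemma inv_mat_of_det_nonzero:
  assumes G: "G \<in> carrier_mat n n" and "det G \<noteq> 0"
  shows "inv_mat G \<in> carrier_mat n n" "G * inv_mat G = 1\<^sub>m n" "inv_mat G * G = 1\<^sub>m n"
proof -
  have "mat_inverse G \<noteq> None"
    \<comment> \<open>The unit value fills the extension slot of the record \<open>ring_mat\<close>,
      so that both facts speak of the units of the same ring.\<close>
    using mat_inverse(1)[OF G, of "()"] det_non_zero_imp_unit[OF G \<open>det G \<noteq> 0\<close>, of "()"] by blast
  then have "mat_inverse G = Some (inv_mat G)"
    by (auto simp: inv_mat_def)
  from mat_inverse(2)[OF G this]
  show "inv_mat G \<in> carrier_mat n n" "G * inv_mat G = 1\<^sub>m n" "inv_mat G * G = 1\<^sub>m n"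
    by auto
qed

text \<open>The increment of a quadratic splits into a part linear in \<open>d\<close> and a part
  quadratic in \<open>d\<close>; stationarity at \<open>s\<close> makes the linear part
  vanish.\<close>

lemma tikhonov_dual_complete_square:
  assumes C: "C \<in> carrier_mat n r" and \<alpha>: "\<alpha> > 0"
    and b: "b \<in> carrier_vec n" and s: "s \<in> carrier_vec n" and d: "d \<in> carrier_vec n"
    and stationary: "(C * transpose_mat C + \<alpha> \<cdot>\<^sub>m 1\<^sub>m n) *\<^sub>v s = \<alpha> \<cdot>\<^sub>v b"
  shows "tikhonov_dual \<alpha> C b (s + d) = tikhonov_dual \<alpha> C b s
           - (1 / (2 * \<alpha>)) * (vec_norm (transpose_mat C *\<^sub>v d))\<^sup>2 - (1 / 2) * (vec_norm d)\<^sup>2"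
proof -
  let ?K = "C * transpose_mat C"
  have K: "?K \<in> carrier_mat n n" using C by auto
  have "\<alpha> * (b \<bullet> d) = (?K *\<^sub>v s + \<alpha> \<cdot>\<^sub>v s) \<bullet> d"
    using b d stationary regularized_gram_mult_vec[OF C s] by (metis smult_scalar_prod_distrib)
  also have "\<dots> = (?K *\<^sub>v s) \<bullet> d + \<alpha> * (s \<bullet> d)"
    using s d mult_mat_vec_carrier[OF K s]
    by (subst add_scalar_prod_distrib[of _ n]) (auto simp del: assoc_mult_mat_vec)
  \<comment> \<open>The stationarity equation, paired with \<open>d\<close> and solved for the mixed
    term.\<close>
  finally have cross: "(transpose_mat C *\<^sub>v s) \<bullet> (transpose_mat C *\<^sub>v d) = \<alpha> * (b \<bullet> d - s \<bullet> d)"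
    unfolding scalar_prod_gram[OF C s d] by (simp add: algebra_simps)
  have "transpose_mat C *\<^sub>v (s + d) = transpose_mat C *\<^sub>v s + transpose_mat C *\<^sub>v d"
    using C s d by (intro mult_add_distrib_mat_vec[of _ r n]) auto
  then have image: "(vec_norm (transpose_mat C *\<^sub>v (s + d)))\<^sup>2 = (vec_norm (transpose_mat C *\<^sub>v s))\<^sup>2
      + 2 * (\<alpha> * (b \<bullet> d - s \<bullet> d)) + (vec_norm (transpose_mat C *\<^sub>v d))\<^sup>2"
    using C s d by (simp add: vec_norm_sq_add[of _ r] cross)
  have "s + d - b = (s - b) + d"
    using b s d by (intro eq_vecI) auto
  then have residual: "(vec_norm (s + d - b))\<^sup>2
      = (vec_norm (s - b))\<^sup>2 + 2 * (s \<bullet> d - b \<bullet> d) + (vec_norm d)\<^sup>2"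
    using b s d by (simp add: vec_norm_sq_add[of _ n] minus_scalar_prod_distrib[of _ n])
  \<comment> \<open>With weights -1/(2\<alpha>) and -1/2, the mixed terms of \<open>image\<close>
    and \<open>residual\<close> become s.d - b.d and b.d - s.d, and cancel.\<close>
  show ?thesis
    unfolding tikhonov_dual_def image residual using \<alpha> by (simp add: field_simps)
qed

text \<open>By the completed square, moving from \<open>s\<close> by d lowers the objective by at
  least |d|^2 / 2, so every other point is strictly worse.\<close>

lemma is_arg_max_tikhonov_dual_iff:
  assumes C: "C \<in> carrier_mat n r" and \<alpha>: "\<alpha> > 0"
    and b: "b \<in> carrier_vec n" and s: "s \<in> carrier_vec n"
    and stationary: "(C * transpose_mat C + \<alpha> \<cdot>\<^sub>m 1\<^sub>m n) *\<^sub>v s = \<alpha> \<cdot>\<^sub>v b"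
  shows "is_arg_max (tikhonov_dual \<alpha> C b) (\<lambda>\<xi>. \<xi> \<in> carrier_vec n) \<xi> \<longleftrightarrow> \<xi> = s"
proof -
  have less: "tikhonov_dual \<alpha> C b \<zeta> < tikhonov_dual \<alpha> C b s"
    if \<zeta>: "\<zeta> \<in> carrier_vec n" and neq: "\<zeta> \<noteq> s" for \<zeta>
  proof -
    have d: "\<zeta> - s \<in> carrier_vec n" and \<zeta>_eq: "s + (\<zeta> - s) = \<zeta>"
      using \<zeta> s by (auto intro!: eq_vecI)
    have "\<zeta> - s \<noteq> 0\<^sub>v n"
      using \<zeta>_eq neq s by auto
    then have "(vec_norm (\<zeta> - s))\<^sup>2 > 0"
      using vec_norm_sq_eq_0_iff[OF d] by (simp add: less_le)
    moreover have "(1 / (2 * \<alpha>)) * (vec_norm (transpose_mat C *\<^sub>v (\<zeta> - s)))\<^sup>2 \<ge> 0"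
      using \<alpha> by simp
    ultimately show ?thesis
      using tikhonov_dual_complete_square[OF C \<alpha> b s d stationary] unfolding \<zeta>_eq by linarith
  qed
  show ?thesis
    unfolding is_arg_max_def using s less by (metis less_asym less_irrefl)
qed

text \<open>For wide \<open>B\<close>, the rows of \<open>Bk\<close> are the columns of the
  approximation of \<open>transpose_mat B\<close>, so the column count of \<open>rsvd_tall\<close>
  enters.\<close>

lemma dim_row_rsvd: "is_rsvd B k p q W Bk \<Longrightarrow> dim_row Bk = dim_row B"
  unfolding is_rsvd_def rsvd_tall_def leading_block_def by (auto split: if_splits)

theorem proposition3p1:
  fixes n m l k p q :: nat
    and A L B \<Gamma> Bk :: "real mat" and b x :: "real vec" and \<alpha> :: real
    and M :: "'w measure" and \<Omega> :: "'w \<Rightarrow> real mat" and \<omega> :: 'w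
  assumes A: "A \<in> carrier_mat n m"
    and b: "b \<in> carrier_vec n"
    and \<alpha>: "\<alpha> > 0"
    and L: "L \<in> carrier_mat l m"
    and \<Gamma>: "\<Gamma> = pinv L * transpose_mat (pinv L)"
    and B: "B = A * pinv L"
    and k: "k \<ge> 1"
    and kp: "k + p \<le> min n l"
    and \<Omega>: "std_gaussian_matrix M (min n l) (k + p) \<Omega>"
    and \<omega>: "\<omega> \<in> space M"
    and Bk: "is_rsvd B k p q (\<Omega> \<omega>) Bk"
    and ker: "mat_kernel L = {0\<^sub>v m}"
    and x: "x = \<Gamma> *\<^sub>v (transpose_mat A *\<^sub>v
              (inv_mat (Bk * transpose_mat Bk + \<alpha> \<cdot>\<^sub>m 1\<^sub>m n) *\<^sub>v b))"
  shows "invertible_mat (Bk * transpose_mat Bk + \<alpha> \<cdot>\<^sub>m 1\<^sub>m n) \<and>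
    (\<exists>!\<xi>. is_arg_max (tikhonov_dual \<alpha> Bk b) (\<lambda>\<xi>. \<xi> \<in> carrier_vec n) \<xi>) \<and>
    (\<forall>\<xi>. is_arg_max (tikhonov_dual \<alpha> Bk b) (\<lambda>\<xi>. \<xi> \<in> carrier_vec n) \<xi> \<longrightarrow>
         (1 / \<alpha>) \<cdot>\<^sub>v (\<Gamma> *\<^sub>v (transpose_mat A *\<^sub>v \<xi>)) = x)"
proof -
  define G where "G = Bk * transpose_mat Bk + \<alpha> \<cdot>\<^sub>m 1\<^sub>m n"
  \<comment> \<open>Setting the gradient -(1/\<alpha>) Bk Bk^T \<xi> - (\<xi> - b) to zero and
    multiplying by -\<alpha> gives \<open>G *\<^sub>v \<xi> = \<alpha> \<cdot>\<^sub>v b\<close>,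
    solved by \<open>s\<close>.\<close>
  define s where "s = \<alpha> \<cdot>\<^sub>v (inv_mat G *\<^sub>v b)"
  \<comment> \<open>The row count of \<open>A * pinv L\<close> is that of \<open>A\<close>;
    \<open>dim_col Bk\<close> instantiates the arbitrary \<open>r\<close> of the lemmas
    above.\<close>
  have C: "Bk \<in> carrier_mat n (dim_col Bk)"
    using dim_row_rsvd[OF Bk] A B by auto
  have G: "G \<in> carrier_mat n n"
    using C unfolding G_def by auto
  have "det G \<noteq> 0"
    unfolding G_def by (rule det_regularized_gram_nonzero[OF C \<alpha>])
  note inv = inv_mat_of_det_nonzero[OF G this]
  have "invertible_mat G"
    using G inv unfolding invertible_mat_def inverts_mat_def by auto
  \<comment> \<open>This equivalence yields the unique existence of the maximizer and reduces the
    claim about every maximizer to \<open>s\<close>.\<close>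
  moreover have arg_max_iff:
    "is_arg_max (tikhonov_dual \<alpha> Bk b) (\<lambda>\<xi>. \<xi> \<in> carrier_vec n) \<xi> \<longleftrightarrow> \<xi> = s" for \<xi>
  proof (rule is_arg_max_tikhonov_dual_iff[OF C \<alpha> b])
    show "s \<in> carrier_vec n"
      using inv(1) b unfolding s_def by auto
    have "G *\<^sub>v s = \<alpha> \<cdot>\<^sub>v ((G * inv_mat G) *\<^sub>v b)"
      using G inv(1) b unfolding s_def by (simp add: mult_mat_vec_smult)
    then show "(Bk * transpose_mat Bk + \<alpha> \<cdot>\<^sub>m 1\<^sub>m n) *\<^sub>v s = \<alpha> \<cdot>\<^sub>v b"
      using inv(2) b unfolding G_def by simp
  qed
  moreover have "(1 / \<alpha>) \<cdot>\<^sub>v (\<Gamma> *\<^sub>v (transpose_mat A *\<^sub>v s)) = x"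
    using \<alpha> unfolding s_def x G_def by (simp add: mult_mat_vec_smult smult_smult_assoc)
  ultimately show ?thesis
    unfolding G_def by simp
qed

end
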